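(* Let $P=\{p_1,\ldots,p_n\}$ be a set of $n$ points on a line. Then the following hold: (a) There exists a set $\mathcal{B}$ of $n-1$ bicolorings of $P$ for which any geometric system of unbiased representatives (G-SUR) consisting of intervals has size at least $n-1$. (b) There exists a set $\mathcal{I}$ of $n-1$ intervals such that for any bicoloring $B$ of $P$ there is at least one interval in $\mathcal{I}$ that is balanced with respect to $B$.
   Context: The line is the real line $\mathbb{R}$ and the points $p_1,\ldots,p_n$ are sorted from left to right. A bicoloring of $P$ is a map $B:P\to\{\text{Red},\text{Blue}\}$ that colors at least one point red and at least one point blue. An interval is balanced with respect to $B$ if the subset of points of $P$ that it contains has the same number of red and blue points with respect to $B$. Given a set $\mathcal{B}$ of bicolorings of $P$, a G-SUR for $\mathcal{B}$ consisting of intervals is a family $\mathcal{O}'$ of intervals such that for every $B\in\mathcal{B}$ at least one interval in $\mathcal{O}'$ is balanced with respect to $B$; its size is the number of intervals in $\mathcal{O}'$.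
   Formalization: Intervals are required to contain at least one point of P, in both (a) and (b); otherwise an interval missing P is balanced (0 = 0) for every bicoloring and is a G-SUR of size 1, so (a) fails for n ≥ 3. *)

theory Defs
  imports "HOL-Analysis.Analysis" "HOL-Library.FuncSet"
begin

datatype colour = Red | Blue

text \<open>A bicoloring is a map defined on \<open>P\<close> only; the extensional function space makes distinct
  bicolorings distinct HOL functions, so that sets of bicolorings can be counted.\<close>

definition bicoloring :: "real set \<Rightarrow> (real \<Rightarrow> colour) \<Rightarrow> bool" where
  "bicoloring P B \<longleftrightarrow>
     B \<in> P \<rightarrow>\<^sub>E {Red, Blue} \<and> (\<exists>p\<in>P. B p = Red) \<and> (\<exists>p\<in>P. B p = Blue)"

definition balanced :: "real set \<Rightarrow> (real \<Rightarrow> colour) \<Rightarrow> real set \<Rightarrow> bool" where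
  "balanced P B J \<longleftrightarrow> card {p \<in> P \<inter> J. B p = Red} = card {p \<in> P \<inter> J. B p = Blue}"

text \<open>Intervals may be open, closed, half-open or unbounded. They have to contain a point of \<open>P\<close>:
  an interval that misses \<open>P\<close> would be balanced (zero points of each colour) for every
  bicoloring.\<close>

definition intervals :: "real set \<Rightarrow> real set set" where
  "intervals P = {J. is_interval J \<and> P \<inter> J \<noteq> {}}"

text \<open>\<open>gsur P R \<B> S\<close>: the subfamily \<open>S\<close> of the family of ranges \<open>R\<close> is a G-SUR for the set of
  bicolorings \<open>\<B>\<close> of \<open>P\<close>.\<close>

definition gsur ::
  "real set \<Rightarrow> real set set \<Rightarrow> (real \<Rightarrow> colour) set \<Rightarrow> real set set \<Rightarrow> bool" where
  "gsur P R \<B> S \<longleftrightarrow> S \<subseteq> R \<and> (\<forall>B\<in>\<B>. \<exists>J\<in>S. balanced P B J)"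

end

theory Submission
  imports Defs
begin

text \<open>
  For (a), take the \<open>n - 1\<close> threshold colorings, red to the left of \<open>t\<close> and blue from \<open>t\<close> on, where
  \<open>t\<close> is any point of \<open>P\<close> but the leftmost. An interval balanced for the thresholds \<open>s < t\<close> would
  contain no point of \<open>P\<close> in \<open>[s, t)\<close>, although it contains points of \<open>P\<close> on both sides of \<open>s\<close>
  and hence \<open>s\<close> itself; so distinct thresholds need distinct intervals. For (b), take the intervals
  spanned by two consecutive points: any bicoloring changes colour somewhere.
\<close>

definition threshold_colouring :: "real set \<Rightarrow> real \<Rightarrow> real \<Rightarrow> colour" where
  "threshold_colouring P t = restrict (\<lambda>x. if x < t then Red else Blue) P"

lemma threshold_colouring_Red:
  "{x \<in> P \<inter> J. threshold_colouring P t x = Red} = {x \<in> P \<inter> J. x < t}"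
  and threshold_colouring_Blue:
  "{x \<in> P \<inter> J. threshold_colouring P t x = Blue} = {x \<in> P \<inter> J. t \<le> x}"
  by (auto simp: threshold_colouring_def split: if_splits)

lemma bicoloring_threshold_colouring:
  assumes "s \<in> P" "t \<in> P" "s < t"
  shows "bicoloring P (threshold_colouring P t)"
  unfolding bicoloring_def
proof (intro conjI)
  show "threshold_colouring P t \<in> P \<rightarrow>\<^sub>E {Red, Blue}"
    by (auto simp: threshold_colouring_def)
  show "\<exists>p\<in>P. threshold_colouring P t p = Red"
    using assms by (intro bexI[of _ s]) (auto simp: threshold_colouring_def)
  show "\<exists>p\<in>P. threshold_colouring P t p = Blue"
    using assms by (intro bexI[of _ t]) (auto simp: threshold_colouring_def)
qed

text \<open>Two such colourings differ at the smaller threshold. This is used to count the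
  colourings in (a).\<close>

lemma inj_on_threshold_colouring: "inj_on (threshold_colouring P) P"
proof (rule linorder_inj_onI)
  fix s t assume "s < t" "s \<in> P" "t \<in> P"
  then have "threshold_colouring P s s = Blue" "threshold_colouring P t s = Red"
    by (auto simp: threshold_colouring_def)
  then show "threshold_colouring P s \<noteq> threshold_colouring P t"
    by auto
qed auto

lemma not_balanced_two_thresholds:
  assumes P: "finite P" and J: "J \<in> intervals P" and "s \<in> P" "s < t"
    and s: "balanced P (threshold_colouring P s) J"
    and t: "balanced P (threshold_colouring P t) J"
  shows False
proof -
  let ?L = "\<lambda>u. {x \<in> P \<inter> J. x < u}" and ?R = "\<lambda>u. {x \<in> P \<inter> J. u \<le> x}"
  have fin: "finite (?L u)" "finite (?R u)" for u
    using P by auto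
  have bal: "card (?L s) = card (?R s)" "card (?L t) = card (?R t)"
    using s t unfolding balanced_def threshold_colouring_Red threshold_colouring_Blue by auto
  have "card (?L s) \<le> card (?L t)" "card (?R t) \<le> card (?R s)"
    using \<open>s < t\<close> by (intro card_mono fin; force)+
  \<comment> \<open>The chain \<open>card (?R s) = card (?L s) \<le> card (?L t) = card (?R t) \<le>
    card (?R s)\<close> collapses, so the inclusion of \<open>?R t\<close> in \<open>?R s\<close> is
    an equality.\<close>
  then have eq: "?R t = ?R s"
    using bal \<open>s < t\<close> by (intro card_subset_eq fin) auto
  obtain p where "p \<in> P \<inter> J"
    using J by (auto simp: intervals_def)
  then have "?L s \<noteq> {} \<or> ?R s \<noteq> {}"
    by force
  \<comment> \<open>Equal cardinalities make both sides nonempty as soon as one is; convexity of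
    \<open>J\<close> then gives \<open>s \<in> J\<close>.\<close>
  then have "?L s \<noteq> {}" "?R s \<noteq> {}"
    using bal(1) fin by (metis card.empty card_0_eq)+
  then have "s \<in> J"
    using J by (auto simp: intervals_def is_interval_1)
  then have "s \<in> ?R t"
    unfolding eq using \<open>s \<in> P\<close> by simp
  then show False
    using \<open>s < t\<close> by simp
qed

text \<open>Choosing for each threshold an interval of \<open>S\<close> balanced for it gives an
  injection from \<open>T\<close> into \<open>S\<close>, by
  \<open>not_balanced_two_thresholds\<close>.\<close>

lemma card_gsur_threshold_colourings:
  assumes P: "finite P" and T: "T \<subseteq> P" and S: "finite S"
    and gsur: "gsur P (intervals P) (threshold_colouring P ` T) S"
  shows "card T \<le> card S"
proof -
  have "\<forall>t\<in>T. \<exists>J. J \<in> S \<and> balanced P (threshold_colouring P t) J"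
    using gsur by (auto simp: gsur_def)
  then obtain f where f: "\<And>t. t \<in> T \<Longrightarrow> f t \<in> S"
      "\<And>t. t \<in> T \<Longrightarrow> balanced P (threshold_colouring P t) (f t)"
    by metis
  have "inj_on f T"
  proof (rule linorder_inj_onI)
    fix s t assume st: "s < t" "s \<in> T" "t \<in> T"
    show "f s \<noteq> f t"
    proof
      assume eq: "f s = f t"
      have "f s \<in> intervals P"
        using f(1) st gsur by (auto simp: gsur_def)
      then show False
        using not_balanced_two_thresholds[of P "f s" s t] P T st f(2)[of s] f(2)[of t] eq by auto
    qed
  qed auto
  then show ?thesis
    using f(1) S by (intro card_inj_on_le[of f]) auto
qed

text \<open>At the leftmost point \<open>Max\<close> is applied to the empty set and its value is
  unspecified; hence the condition \<open>t \<in> P - {Min P}\<close> below.\<close>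

definition pred_in :: "real set \<Rightarrow> real \<Rightarrow> real" where
  "pred_in P t = Max {x \<in> P. x < t}"

lemma pred_in:
  assumes "finite P" "t \<in> P - {Min P}"
  shows "pred_in P t \<in> P" "pred_in P t < t"
    and "x \<in> P \<Longrightarrow> x < t \<Longrightarrow> x \<le> pred_in P t"
proof -
  have "Min P \<in> {x \<in> P. x < t}"
    using assms by (auto simp: order_less_le intro: Min_in Min_le)
  then have "pred_in P t \<in> {x \<in> P. x < t}"
    unfolding pred_in_def using assms(1) by (intro Max_in) auto
  then show "pred_in P t \<in> P" "pred_in P t < t"
    by auto
  show "x \<le> pred_in P t" if "x \<in> P" "x < t"
    unfolding pred_in_def using assms(1) that by (intro Max_ge) auto
qed

text \<open>No point of \<open>P\<close> lies strictly between the endpoints, so the interval holds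
  just two points of \<open>P\<close>, one of each colour.\<close>

lemma balanced_consecutive:
  assumes P: "finite P" "t \<in> P - {Min P}" and B: "B (pred_in P t) \<noteq> B t"
  shows "balanced P B {pred_in P t..t}"
proof -
  let ?s = "pred_in P t"
  have "P \<inter> {?s..t} = {?s, t}"
    using pred_in[OF P] P(2) by (force simp: order_le_less)
  then have *: "{x \<in> P \<inter> {?s..t}. B x = c} = {x \<in> {?s, t}. B x = c}" for c
    by auto
  have "{x \<in> {?s, t}. B x = Red} = {?s} \<and> {x \<in> {?s, t}. B x = Blue} = {t} \<or>
        {x \<in> {?s, t}. B x = Red} = {t} \<and> {x \<in> {?s, t}. B x = Blue} = {?s}"
    using B by (cases "B ?s"; cases "B t") auto
  then show ?thesis
    unfolding balanced_def * by auto
qed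

text \<open>Take for \<open>t\<close> the leftmost point coloured unlike \<open>Min P\<close>: by
  minimality its predecessor still has the colour of \<open>Min P\<close>.\<close>

lemma bicoloring_colour_change:
  assumes P: "finite P" and B: "bicoloring P B"
  obtains t where "t \<in> P - {Min P}" "B (pred_in P t) \<noteq> B t"
proof -
  define D where "D = {x \<in> P. B x \<noteq> B (Min P)}"
  have "finite D" "D \<noteq> {}"
    using P B by (auto simp: D_def bicoloring_def) (metis colour.distinct(1))
  then have t: "Min D \<in> D" "\<And>x. x \<in> D \<Longrightarrow> Min D \<le> x"
    by auto
  then have tP: "Min D \<in> P - {Min P}"
    by (auto simp: D_def)
  have "pred_in P (Min D) \<notin> D"
    using t(2) pred_in(2)[OF P tP] by force
  then have "B (pred_in P (Min D)) \<noteq> B (Min D)"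
    using t(1) pred_in(1)[OF P tP] by (auto simp: D_def)
  with tP show thesis
    by (rule that)
qed

theorem theorem1:
  fixes P :: "real set" and n :: nat
  assumes "n \<ge> 1" and "finite P" and "card P = n"
  shows "(\<exists>\<B>. (\<forall>B\<in>\<B>. bicoloring P B) \<and> finite \<B> \<and> card \<B> = n - 1 \<and>
            (\<forall>S. gsur P (intervals P) \<B> S \<longrightarrow> infinite S \<or> card S \<ge> n - 1))
       \<and> (\<exists>\<I>. \<I> \<subseteq> intervals P \<and> finite \<I> \<and> card \<I> = n - 1 \<and>
            (\<forall>B. bicoloring P B \<longrightarrow> (\<exists>J\<in>\<I>. balanced P B J)))"
proof -
  \<comment> \<open>\<open>T\<close> serves both parts: as the thresholds in (a) and as the right
    endpoints of the intervals in (b).\<close>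
  define T where "T = P - {Min P}"
  have "P \<noteq> {}"
    using assms by auto
  then have T: "finite T" "T \<subseteq> P" "card T = n - 1"
    using assms by (auto simp: T_def card_Diff_singleton)
  note pred = pred_in[OF \<open>finite P\<close>, folded T_def]
  show ?thesis
  proof (intro conjI exI)
    have "bicoloring P (threshold_colouring P t)" if "t \<in> T" for t
      using pred(1,2)[OF that] T(2) that by (intro bicoloring_threshold_colouring) auto
    then show "\<forall>B\<in>threshold_colouring P ` T. bicoloring P B"
      by blast
    show "finite (threshold_colouring P ` T)"
      using T(1) by simp
    show "card (threshold_colouring P ` T) = n - 1"
      using T inj_on_subset[OF inj_on_threshold_colouring] by (simp add: card_image)
    show "\<forall>S. gsur P (intervals P) (threshold_colouring P ` T) S \<longrightarrow> infinite S \<or> n - 1 \<le> card S"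
      using card_gsur_threshold_colourings[OF \<open>finite P\<close> T(2)] T(3) by auto
  next
    let ?I = "\<lambda>t. {pred_in P t..t}"
    show "?I ` T \<subseteq> intervals P"
    proof (rule image_subsetI)
      fix t assume "t \<in> T"
      then have "t \<in> P \<inter> ?I t"
        using pred(2)[of t] T(2) by auto
      then show "?I t \<in> intervals P"
        by (auto simp: intervals_def is_interval_cc)
    qed
    show "finite (?I ` T)"
      using T(1) by simp
    \<comment> \<open>Each interval is nonempty by \<open>pred(2)\<close>, so it determines its
      right endpoint.\<close>
    have "inj_on ?I T"
      using pred(2) by (intro inj_onI) (simp add: Icc_eq_Icc less_imp_le)
    then show "card (?I ` T) = n - 1"
      using T(3) by (simp add: card_image)
    show "\<forall>B. bicoloring P B \<longrightarrow> (\<exists>J\<in>?I ` T. balanced P B J)"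
    proof (intro allI impI)
      fix B assume "bicoloring P B"
      then obtain t where t: "t \<in> P - {Min P}" "B (pred_in P t) \<noteq> B t"
        by (rule bicoloring_colour_change[OF \<open>finite P\<close>])
      then have "balanced P B (?I t)"
        by (rule balanced_consecutive[OF \<open>finite P\<close>])
      then show "\<exists>J\<in>?I ` T. balanced P B J"
        using t(1) unfolding T_def by (intro bexI[OF _ imageI])
    qed
  qed
qed

end
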